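(* Let $c_0>0$. There is a constant $C>0$ depending only on $c_0$ such that the following holds. Let $E \subset B(0,1)$ be a compact set, and let $\omega,\omega' \in S^1$ satisfy $\angle(\omega,\omega') \ge c_0$ and $\angle(\omega,-\omega') \ge c_0$. Suppose $0 < r_N < r_{N-1} < \dots < r_1 \le 1$ are scales such that each $r_n$ is a negative power of two (in particular $r_{n+1} \le \frac12 r_n$ for $1\le n<N$), and such that, with $E_\omega := \{x\cdot\omega : x \in E\}$ and $E_{\omega'} := \{x\cdot\omega' : x \in E\}$, $$m(\mathcal{N}_{r_{n+1}}(E_\omega)) \le r_n \quad\text{and}\quad m(\mathcal{N}_{r_{n+1}}(E_{\omega'})) \le r_n$$ for all $1 \le n < N$. Then $R_E(r_N, 1, N^{1/100}) \le C N^{-1/100}$.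
   Context: $B(0,1)$ is the open unit ball of $\mathbb{R}^2$, $m$ is Lebesgue measure on $\mathbb{R}$, $\angle(\omega,\omega')\in[0,\pi]$ is the angle between unit vectors, and $\mathcal{N}_r(A)$ is the open $r$-neighbourhood of $A \subset \mathbb{R}$. For $\varepsilon, r, M > 0$ the rectifiability constant is $$R_E(\varepsilon,r,M) = \sup \frac{m(\{x \in J : x\omega_1 + (F(x)+y)\omega_2 \in E \text{ for some } -\varepsilon \le y \le \varepsilon\})}{m(J)},$$ the supremum over all orthonormal $\omega_1,\omega_2 \in S^1$, all $F:\mathbb{R}\to\mathbb{R}$ with Lipschitz constant at most $M$, and all intervals $J \subset \mathbb{R}$ of length at least $r$. *)

theory Defs
  imports "HOL-Analysis.Analysis"
begin

definition uangle :: "real^2 \<Rightarrow> real^2 \<Rightarrow> real" where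
  "uangle w w' = arccos (w \<bullet> w')"

definition nbhd :: "real \<Rightarrow> real set \<Rightarrow> real set" where
  "nbhd r A = {x. \<exists>a\<in>A. \<bar>x - a\<bar> < r}"

definition proj :: "(real^2) set \<Rightarrow> real^2 \<Rightarrow> real set" where
  "proj E w = (\<lambda>x. x \<bullet> w) ` E"

definition graph_hit :: "(real^2) set \<Rightarrow> real^2 \<Rightarrow> real^2 \<Rightarrow> (real \<Rightarrow> real) \<Rightarrow> real \<Rightarrow> real set \<Rightarrow> real set" where
  "graph_hit E w1 w2 F eps J =
     {x \<in> J. \<exists>y. - eps \<le> y \<and> y \<le> eps \<and> x *\<^sub>R w1 + (F x + y) *\<^sub>R w2 \<in> E}"

definition rect_const :: "(real^2) set \<Rightarrow> real \<Rightarrow> real \<Rightarrow> real \<Rightarrow> real" where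
  "rect_const E eps r M = Sup
     {measure lebesgue (graph_hit E w1 w2 F eps {a..b}) / measure lebesgue {a..b} | w1 w2 F a b.
        norm w1 = 1 \<and> norm w2 = 1 \<and> w1 \<bullet> w2 = 0 \<and> M-lipschitz_on UNIV F \<and> b - a \<ge> r}"

end

theory Submission
  imports Defs
begin

text \<open>
  Write the graph as a curve, and let f and g be its components along the two given directions.
  For a dyadic scale let V be the sum of the variations of f and g over the dyadic points of that
  scale in [-1,1]; V grows as the scale shrinks and is bounded by a multiple of the Lipschitz
  constant. Compare a coarse scale slightly above r_n with a fine scale slightly below r_{n+1}.
  The image under f of a coarse interval I has length at least the increment of f over I, and it
  is covered by the images of the fine intervals missing the hit set G together with the
  r_{n+1}-neighbourhood of the projection of E, whose measure is at most r_n. Hence passing from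
  the coarse to the fine scale gains, up to a small error, the variation of f over the fine
  intervals that meet G. By transversality the gains for f and g add up to at least c m(G), so the
  boundedness of V limits the number of scales at which this can happen.
\<close>

section \<open>Variation along a chain of real numbers\<close>

lemma closed_segment_chain_subset:
  fixes h :: "nat \<Rightarrow> real"
  assumes "a < b"
  shows "closed_segment (h a) (h b) \<subseteq> (\<Union>i\<in>{a..<b}. closed_segment (h i) (h (Suc i)))"
  using assms
proof (induction b)
  case (Suc n)
  show ?case
  proof (cases "a = n")
    case True
    then show ?thesis by simp
  next
    case False
    have "closed_segment (h a) (h (Suc n)) \<subseteq> closed_segment (h a) (h n) \<union> closed_segment (h n) (h (Suc n))"
      by (auto simp: closed_segment_eq_real_ivl)
    with Suc False show ?thesis
      by (fastforce simp: atLeastLessThanSuc)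
  qed
qed simp

lemma measure_closed_segment_real:
  fixes a b :: real
  shows "measure lebesgue (closed_segment a b) = \<bar>b - a\<bar>"
  by (simp add: closed_segment_eq_real_ivl)

lemma lmeasurable_closed_segment_real:
  fixes a b :: real
  shows "closed_segment a b \<in> lmeasurable"
  by (simp add: closed_segment_eq_real_ivl)

text \<open>The step segments cover the segment from \<open>h a\<close> to \<open>h b\<close>. Those
  indexed by \<open>B\<close> all lie in \<open>S\<close>, so together they contribute at most the
  measure of \<open>S\<close>, however many there are and however often they retrace it.\<close>

lemma abs_diff_le_sum_unhit:
  fixes h :: "nat \<Rightarrow> real"
  assumes S: "S \<in> lmeasurable" and "a \<le> b"
    and seg: "\<And>i. \<lbrakk>a \<le> i; i < b; i \<in> B\<rbrakk> \<Longrightarrow> closed_segment (h i) (h (Suc i)) \<subseteq> S"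
  shows "\<bar>h b - h a\<bar> \<le> (\<Sum>i\<in>{a..<b} - B. \<bar>h (Suc i) - h i\<bar>) + measure lebesgue S"
proof (cases "a = b")
  case True
  then show ?thesis by simp
next
  case False
  let ?U = "\<Union>i\<in>{a..<b} - B. closed_segment (h i) (h (Suc i))"
  have U: "?U \<in> lmeasurable"
    by (intro fmeasurable.finite_UN lmeasurable_closed_segment_real) auto
  have "closed_segment (h a) (h b) \<subseteq> (\<Union>i\<in>{a..<b}. closed_segment (h i) (h (Suc i)))"
    using False \<open>a \<le> b\<close> by (intro closed_segment_chain_subset) auto
  also have "\<dots> \<subseteq> ?U \<union> S"
    using seg by fastforce
  finally have "measure lebesgue (closed_segment (h a) (h b)) \<le> measure lebesgue (?U \<union> S)"
    using U S by (intro measure_mono_fmeasurable) (auto simp: lmeasurable_closed_segment_real fmeasurableD)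
  also have "\<dots> \<le> measure lebesgue ?U + measure lebesgue S"
    using U S by (intro measure_Un_le) (auto simp: fmeasurableD)
  also have "measure lebesgue ?U \<le> (\<Sum>i\<in>{a..<b} - B. measure lebesgue (closed_segment (h i) (h (Suc i))))"
    by (intro measure_UNION_le) (auto simp: lmeasurable_closed_segment_real fmeasurableD)
  finally show ?thesis
    by (simp add: measure_closed_segment_real)
qed

lemma coarse_plus_hit_variation_le:
  fixes h :: "nat \<Rightarrow> real"
  assumes S: "S \<in> lmeasurable"
    and seg: "\<And>i. i \<in> B \<Longrightarrow> closed_segment (h i) (h (Suc i)) \<subseteq> S"
    and B: "B \<subseteq> {..<m * n}"
  shows "(\<Sum>j<m. \<bar>h (Suc j * n) - h (j * n)\<bar>) + (\<Sum>i\<in>B. \<bar>h (Suc i) - h i\<bar>)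
      \<le> (\<Sum>i<m * n. \<bar>h (Suc i) - h i\<bar>) + real m * measure lebesgue S"
proof -
  define d where "d i = \<bar>h (Suc i) - h i\<bar>" for i
  \<comment> \<open>Setting the steps in \<open>B\<close> to zero, instead of removing their
    indices, lets \<open>sum.nat_group\<close> join the blocks.\<close>
  define d' where "d' i = (if i \<in> B then 0 else d i)" for i
  have "\<bar>h (Suc j * n) - h (j * n)\<bar> \<le> sum d' {j * n..<j * n + n} + measure lebesgue S" for j
  proof -
    have "\<bar>h (Suc j * n) - h (j * n)\<bar> \<le> sum d ({j * n..<j * n + n} - B) + measure lebesgue S"
      unfolding d_def using abs_diff_le_sum_unhit[OF S, of "j * n" "j * n + n" B h] seg
      by (simp add: add.commute)
    also have "sum d ({j * n..<j * n + n} - B) = sum d' {j * n..<j * n + n}"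
      by (rule sum.mono_neutral_cong_left) (auto simp: d'_def)
    finally show ?thesis .
  qed
  then have "(\<Sum>j<m. \<bar>h (Suc j * n) - h (j * n)\<bar>)
      \<le> (\<Sum>j<m. sum d' {j * n..<j * n + n} + measure lebesgue S)"
    by (rule sum_mono)
  also have "\<dots> = sum d' {..<m * n} + real m * measure lebesgue S"
    by (simp add: sum.distrib sum.nat_group)
  finally have 1: "(\<Sum>j<m. \<bar>h (Suc j * n) - h (j * n)\<bar>) \<le> sum d' {..<m * n} + real m * measure lebesgue S" .
  have "sum d' {..<m * n} = sum d ({..<m * n} - B)"
    by (rule sum.mono_neutral_cong_right) (auto simp: d'_def)
  also have "\<dots> = sum d {..<m * n} - sum d B"
    using B by (simp add: sum_diff)
  finally show ?thesis
    using 1 unfolding d_def by linarith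
qed

section \<open>Dyadic variation on [-1,1]\<close>

definition dyadic_pt :: "nat \<Rightarrow> nat \<Rightarrow> real" where
  "dyadic_pt e i = -1 + real i / 2 ^ e"

definition dyadic_variation :: "(real \<Rightarrow> real) \<Rightarrow> nat \<Rightarrow> real" where
  "dyadic_variation h e = (\<Sum>i<2 ^ Suc e. \<bar>h (dyadic_pt e (Suc i)) - h (dyadic_pt e i)\<bar>)"

text \<open>The intervals are closed, so a point of \<open>G\<close> on the grid may count for two
  neighbours. This is harmless: only a lower bound on the number of hits is used.\<close>

definition dyadic_hits :: "real set \<Rightarrow> nat \<Rightarrow> nat set" where
  "dyadic_hits G e = {i. i < 2 ^ Suc e \<and> G \<inter> {dyadic_pt e i..dyadic_pt e (Suc i)} \<noteq> {}}"

lemma dyadic_pt_refine: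
  assumes "e \<le> e'"
  shows "dyadic_pt e' (j * 2 ^ (e' - e)) = dyadic_pt e j"
proof -
  have "(2::real) ^ e' = 2 ^ e * 2 ^ (e' - e)"
    using assms by (simp flip: power_add)
  then show ?thesis by (simp add: dyadic_pt_def)
qed

lemma dyadic_pt_Suc: "dyadic_pt e (Suc i) = dyadic_pt e i + 1 / 2 ^ e"
  by (simp add: dyadic_pt_def add_divide_distrib)

lemma finite_dyadic_hits: "finite (dyadic_hits G e)"
  by (rule finite_subset[of _ "{..<2 ^ Suc e}"]) (auto simp: dyadic_hits_def)

text \<open>Each coarse interval is a block of \<open>2 ^ (e' - e)\<close> fine ones. Both endpoints
  of a fine interval that meets \<open>G\<close> are within \<open>1 / 2 ^ e'\<close> of a point of
  \<open>G\<close>, so the hypothesis on nearby \<open>x\<close>, \<open>y\<close> puts its value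
  segment in \<open>S\<close>.\<close>

lemma dyadic_variation_gain:
  assumes S: "S \<in> lmeasurable" and "e \<le> e'"
    and seg: "\<And>x y z. \<lbrakk>z \<in> G; \<bar>x - z\<bar> \<le> 1 / 2 ^ e'; \<bar>y - z\<bar> \<le> 1 / 2 ^ e'\<rbrakk>
      \<Longrightarrow> closed_segment (h x) (h y) \<subseteq> S"
  shows "dyadic_variation h e
      + (\<Sum>i\<in>dyadic_hits G e'. \<bar>h (dyadic_pt e' (Suc i)) - h (dyadic_pt e' i)\<bar>)
      \<le> dyadic_variation h e' + 2 ^ Suc e * measure lebesgue S"
proof -
  have eq: "(2::nat) ^ Suc e * 2 ^ (e' - e) = 2 ^ Suc e'"
    using \<open>e \<le> e'\<close> by (simp flip: power_add)
  have s: "closed_segment (h (dyadic_pt e' i)) (h (dyadic_pt e' (Suc i))) \<subseteq> S"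
    if i: "i \<in> dyadic_hits G e'" for i
  proof -
    obtain z where "z \<in> G" "dyadic_pt e' i \<le> z" "z \<le> dyadic_pt e' (Suc i)"
      using i by (auto simp: dyadic_hits_def)
    then show ?thesis
      using dyadic_pt_Suc[of e' i] by (intro seg[of z]) (auto simp: abs_if)
  qed
  have B: "dyadic_hits G e' \<subseteq> {..<2 ^ Suc e * 2 ^ (e' - e)}"
    unfolding eq by (auto simp: dyadic_hits_def)
  show ?thesis
    using coarse_plus_hit_variation_le[where h = "\<lambda>i. h (dyadic_pt e' i)", OF S s B]
    unfolding eq dyadic_variation_def dyadic_pt_refine[OF \<open>e \<le> e'\<close>] by simp
qed

lemma dyadic_variation_mono:
  assumes "e \<le> e'"
  shows "dyadic_variation h e \<le> dyadic_variation h e'"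
  \<comment> \<open>With empty \<open>G\<close> and \<open>S\<close> both the gain and the error
    vanish.\<close>
  using dyadic_variation_gain[of "{}" e e' "{}" h] assms by (simp add: dyadic_hits_def)

lemma dyadic_variation_nonneg: "0 \<le> dyadic_variation h e"
  unfolding dyadic_variation_def by (intro sum_nonneg) auto

lemma dyadic_variation_lipschitz:
  assumes "\<And>x y. \<bar>h x - h y\<bar> \<le> D * \<bar>x - y\<bar>"
  shows "dyadic_variation h e \<le> 2 * D"
proof -
  have "\<bar>h (dyadic_pt e (Suc i)) - h (dyadic_pt e i)\<bar> \<le> D / 2 ^ e" for i
    using assms[of "dyadic_pt e (Suc i)" "dyadic_pt e i"] by (simp add: dyadic_pt_Suc)
  then have "dyadic_variation h e \<le> (\<Sum>i<(2::nat) ^ Suc e. D / 2 ^ e)"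
    unfolding dyadic_variation_def by (intro sum_mono)
  then show ?thesis by simp
qed

text \<open>The intervals counted cover \<open>G\<close>. The right end 1 is excluded because its
  floor index would be \<open>2 ^ Suc e\<close>, one past the last interval.\<close>

lemma measure_le_dyadic_hits:
  assumes G: "G \<subseteq> {-1..<1}"
  shows "measure lebesgue G \<le> real (card (dyadic_hits G e)) / 2 ^ e"
proof (cases "G \<in> sets lebesgue")
  case False
  \<comment> \<open>By convention \<open>measure\<close> is 0 on sets that are not
    measurable.\<close>
  then show ?thesis by (simp add: measure_notin_sets)
next
  case True
  let ?J = "\<lambda>i. {dyadic_pt e i..dyadic_pt e (Suc i)}"
  have "G \<subseteq> (\<Union>i\<in>dyadic_hits G e. ?J i)"
  proof
    fix z assume z: "z \<in> G"
    then have z1: "-1 \<le> z" "z < 1" using G by auto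
    define i where "i = nat \<lfloor>(z + 1) * 2 ^ e\<rfloor>"
    have nn: "0 \<le> (z + 1) * 2 ^ e" using z1 by simp
    have i: "real i \<le> (z + 1) * 2 ^ e" "(z + 1) * 2 ^ e < real i + 1"
      unfolding i_def using nn by (auto simp: of_nat_nat)
    have "(z + 1) * 2 ^ e < 2 * 2 ^ e" using z1 by simp
    with i(1) have "real i < 2 * 2 ^ e" by (rule le_less_trans)
    then have "real i < real (2 ^ Suc e)" by simp
    then have "i < 2 ^ Suc e" by (simp only: of_nat_less_iff)
    moreover have "z \<in> ?J i"
      using i by (auto simp: dyadic_pt_def field_simps)
    ultimately show "z \<in> (\<Union>i\<in>dyadic_hits G e. ?J i)" using z unfolding dyadic_hits_def by blast
  qed
  then have "measure lebesgue G \<le> measure lebesgue (\<Union>i\<in>dyadic_hits G e. ?J i)"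
    using True by (intro measure_mono_fmeasurable fmeasurable.finite_UN finite_dyadic_hits) auto
  also have "\<dots> \<le> (\<Sum>i\<in>dyadic_hits G e. measure lebesgue (?J i))"
    by (intro measure_UNION_le finite_dyadic_hits) auto
  also have "\<dots> = real (card (dyadic_hits G e)) / 2 ^ e"
    by (simp add: dyadic_pt_Suc)
  finally show ?thesis .
qed

section \<open>Gains controlled by a neighbourhood\<close>

lemma nbhd_eq_Union_ball: "nbhd r A = (\<Union>a\<in>A. ball a r)"
  by (auto simp: nbhd_def dist_real_def abs_minus_commute)

lemma nbhd_lmeasurable:
  assumes "bounded A"
  shows "nbhd r A \<in> lmeasurable"
proof (rule lmeasurable_open)
  obtain B where B: "\<And>a. a \<in> A \<Longrightarrow> \<bar>a\<bar> \<le> B"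
    using assms by (auto simp: bounded_iff)
  show "bounded (nbhd r A)"
    unfolding bounded_iff nbhd_def using B by (intro exI[of _ "B + r"]) fastforce
  show "open (nbhd r A)"
    unfolding nbhd_eq_Union_ball by auto
qed

text \<open>Here \<open>S\<close> is the neighbourhood of \<open>A\<close>: at a hit,
  \<open>h\<close> is \<open>\<epsilon>\<close>-close to \<open>A\<close>, and along one fine
  interval the Lipschitz bound moves the value by at most \<open>D / 2 ^ e'\<close>.\<close>

lemma dyadic_variation_gain_nbhd:
  assumes lip: "\<And>x y. \<bar>h x - h y\<bar> \<le> D * \<bar>x - y\<bar>" and "0 \<le> D"
    and A: "bounded A" and near: "\<And>x. x \<in> G \<Longrightarrow> \<exists>a\<in>A. \<bar>h x - a\<bar> \<le> \<epsilon>"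
    and "e \<le> e'" and \<rho>: "\<epsilon> + D / 2 ^ e' < \<rho>"
    and small: "measure lebesgue (nbhd \<rho> A) \<le> \<sigma>"
  shows "dyadic_variation h e
      + (\<Sum>i\<in>dyadic_hits G e'. \<bar>h (dyadic_pt e' (Suc i)) - h (dyadic_pt e' i)\<bar>)
      \<le> dyadic_variation h e' + 2 ^ Suc e * \<sigma>"
proof -
  have "closed_segment (h x) (h y) \<subseteq> nbhd \<rho> A"
    if z: "z \<in> G" and x: "\<bar>x - z\<bar> \<le> 1 / 2 ^ e'" and y: "\<bar>y - z\<bar> \<le> 1 / 2 ^ e'" for x y z
  proof
    fix u assume u: "u \<in> closed_segment (h x) (h y)"
    obtain a where a: "a \<in> A" "\<bar>h z - a\<bar> \<le> \<epsilon>" using near[OF z] by auto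
    have "\<bar>h x - h z\<bar> \<le> D / 2 ^ e'" "\<bar>h y - h z\<bar> \<le> D / 2 ^ e'"
      using lip[of x z] lip[of y z] mult_left_mono[OF x \<open>0 \<le> D\<close>] mult_left_mono[OF y \<open>0 \<le> D\<close>] by auto
    then have "\<bar>u - h z\<bar> \<le> D / 2 ^ e'"
      using u by (auto simp: closed_segment_eq_real_ivl split: if_splits)
    then have "\<bar>u - a\<bar> < \<rho>" using a \<rho> by linarith
    then show "u \<in> nbhd \<rho> A" using a by (auto simp: nbhd_def)
  qed
  then have "dyadic_variation h e
      + (\<Sum>i\<in>dyadic_hits G e'. \<bar>h (dyadic_pt e' (Suc i)) - h (dyadic_pt e' i)\<bar>)
      \<le> dyadic_variation h e' + 2 ^ Suc e * measure lebesgue (nbhd \<rho> A)"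
    by (intro dyadic_variation_gain nbhd_lmeasurable A \<open>e \<le> e'\<close>) auto
  also have "\<dots> \<le> dyadic_variation h e' + 2 ^ Suc e * \<sigma>"
    using small by simp
  finally show ?thesis .
qed

section \<open>Telescoping over the scales\<close>

lemma exponent_growth:
  fixes e :: "nat \<Rightarrow> nat"
  assumes "\<And>n. \<lbrakk>1 \<le> n; n < N\<rbrakk> \<Longrightarrow> e n < e (Suc n)" and "1 \<le> a" "a + d \<le> N"
  shows "e a + d \<le> e (a + d)"
  using assms(3)
proof (induction d)
  case (Suc d)
  then show ?case using assms(1)[of "a + d"] assms(2) by simp
qed simp

text \<open>
  The n-th comparison is between the scales 2^q r_n and r_{n+1} / 2^p. Taking only every
  (p + q + 1)-th n makes the ranges of scales disjoint, so that the gains telescope.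
\<close>

lemma multiscale_variation_bound:
  fixes f g :: "real \<Rightarrow> real" and e :: "nat \<Rightarrow> nat"
  assumes lipf: "\<And>x y. \<bar>f x - f y\<bar> \<le> D * \<bar>x - y\<bar>"
    and lipg: "\<And>x y. \<bar>g x - g y\<bar> \<le> D * \<bar>x - y\<bar>"
    and trans: "\<And>x y. c * \<bar>x - y\<bar> \<le> \<bar>f x - f y\<bar> + \<bar>g x - g y\<bar>"
    and "0 \<le> D" "0 \<le> c" and G: "G \<subseteq> {-1..<1}"
    and A: "bounded A" "\<And>x. x \<in> G \<Longrightarrow> \<exists>a\<in>A. \<bar>f x - a\<bar> \<le> 1 / 2 ^ e N"
    and A': "bounded A'" "\<And>x. x \<in> G \<Longrightarrow> \<exists>a\<in>A'. \<bar>g x - a\<bar> \<le> 1 / 2 ^ e N"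
    and e: "\<And>n. \<lbrakk>1 \<le> n; n < N\<rbrakk> \<Longrightarrow> e n < e (Suc n)"
    and small: "\<And>n. \<lbrakk>1 \<le> n; n < N\<rbrakk> \<Longrightarrow> measure lebesgue (nbhd (1 / 2 ^ e (Suc n)) A) \<le> 1 / 2 ^ e n"
    and small': "\<And>n. \<lbrakk>1 \<le> n; n < N\<rbrakk> \<Longrightarrow> measure lebesgue (nbhd (1 / 2 ^ e (Suc n)) A') \<le> 1 / 2 ^ e n"
    and p: "4 * D \<le> 2 ^ p" "1 \<le> p"
    and L: "q + 1 + L * (p + q + 1) \<le> N"
  shows "real L * (c * measure lebesgue G - 4 / 2 ^ q) \<le> 4 * D"
proof -
  define V where "V s = dyadic_variation f s + dyadic_variation g s" for s
  \<comment> \<open>The guaranteed gain of one comparison: the transversality term minus an error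
    \<open>2 / 2 ^ q\<close> for each of \<open>f\<close> and \<open>g\<close>.\<close>
  define \<kappa> where "\<kappa> = c * measure lebesgue G - 4 / 2 ^ q"
  \<comment> \<open>Starting at \<open>q + 1\<close> ensures \<open>q \<le> e (n i)\<close>, so the
    natural-number subtraction \<open>e (n i) - q\<close> is never truncated.\<close>
  define n where "n i = q + 1 + i * (p + q + 1)" for i
  have grow: "e a + d \<le> e (a + d)" if "1 \<le> a" "a + d \<le> N" for a d
    using exponent_growth[of N e a d] e that by blast
  have gain: "V (e m - q) + \<kappa> \<le> V (e (Suc m) + p)"
    if m: "q + 1 \<le> m" "Suc m < N" for m
  proof -
    let ?s = "e m - q" and ?t = "e (Suc m) + p"
    have "q \<le> e m" using grow[of 1 "m - 1"] m by simp
    have st: "?s \<le> ?t" using e[of m] m by simp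
    \<comment> \<open>Since \<open>Suc m < N\<close>, the thickness \<open>1 / 2 ^ e N\<close> uses
      at most half of the radius \<open>1 / 2 ^ e (Suc m)\<close>. The choice of \<open>p\<close>
      limits the Lipschitz error to a quarter.\<close>
    have "e (Suc m) + 1 \<le> e N"
      using grow[of "Suc m" "N - Suc m"] m by simp
    then have "(2::real) ^ (e (Suc m) + 1) \<le> 2 ^ e N"
      by (intro power_increasing) auto
    then have half: "1 / 2 ^ e N \<le> (1/2) * (1 / (2::real) ^ e (Suc m))"
      by (simp add: field_simps)
    have "D / 2 ^ ?t \<le> (1/4) * (1 / (2::real) ^ e (Suc m))"
      using p by (simp add: field_simps power_add)
    moreover have "0 < 1 / (2::real) ^ e (Suc m)" by simp
    ultimately have \<rho>: "1 / 2 ^ e N + D / 2 ^ ?t < 1 / 2 ^ e (Suc m)"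
      using half by linarith
    let ?H = "dyadic_hits G ?t"
    let ?d = "\<lambda>h i. \<bar>h (dyadic_pt ?t (Suc i)) - h (dyadic_pt ?t i)\<bar>"
    have 1: "dyadic_variation f ?s + (\<Sum>i\<in>?H. ?d f i) \<le> dyadic_variation f ?t + 2 ^ Suc ?s * (1 / 2 ^ e m)"
      using m by (intro dyadic_variation_gain_nbhd[OF lipf \<open>0 \<le> D\<close> A st \<rho>] small) auto
    have 2: "dyadic_variation g ?s + (\<Sum>i\<in>?H. ?d g i) \<le> dyadic_variation g ?t + 2 ^ Suc ?s * (1 / 2 ^ e m)"
      using m by (intro dyadic_variation_gain_nbhd[OF lipg \<open>0 \<le> D\<close> A' st \<rho>] small') auto
    \<comment> \<open>Each hit interval contributes at least \<open>c\<close> times its length to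
      the joint variation, and the hit intervals have total length at least the measure of
      \<open>G\<close>.\<close>
    have "c / 2 ^ ?t \<le> ?d f i + ?d g i" for i
      using trans[of "dyadic_pt ?t (Suc i)" "dyadic_pt ?t i"] by (simp add: dyadic_pt_Suc)
    then have "(\<Sum>i\<in>?H. c / 2 ^ ?t) \<le> (\<Sum>i\<in>?H. ?d f i + ?d g i)"
      by (intro sum_mono)
    then have 3: "c * (real (card ?H) / 2 ^ ?t) \<le> (\<Sum>i\<in>?H. ?d f i) + (\<Sum>i\<in>?H. ?d g i)"
      by (simp add: sum.distrib mult.commute)
    have 4: "c * measure lebesgue G \<le> c * (real (card ?H) / 2 ^ ?t)"
      using measure_le_dyadic_hits[OF G, of ?t] \<open>0 \<le> c\<close> by (rule mult_left_mono)
    \<comment> \<open>There are \<open>2 ^ Suc ?s\<close> coarse intervals, each losing at most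
      \<open>1 / 2 ^ e m\<close>. Being coarser by \<open>q\<close> levels makes the total loss
      \<open>2 / 2 ^ q\<close>.\<close>
    have "(2::real) ^ e m = 2 ^ ?s * 2 ^ q"
      using \<open>q \<le> e m\<close> by (simp flip: power_add)
    then have "2 ^ Suc ?s * (1 / 2 ^ e m) = 2 / (2::real) ^ q" by simp
    with 1 2 3 4 show ?thesis unfolding V_def \<kappa>_def by (simp add: algebra_simps)
  qed
  have V_mono: "V s \<le> V t" if "s \<le> t" for s t
    unfolding V_def using that by (intro add_mono dyadic_variation_mono)
  have "i \<le> L \<Longrightarrow> real i * \<kappa> \<le> V (e (n i) - q)" for i
  proof (induction i)
    case 0
    then show ?case by (simp add: V_def dyadic_variation_nonneg)
  next
    case (Suc i)
    have "n (Suc i) \<le> n L" unfolding n_def using Suc.prems by (intro add_left_mono mult_right_mono) auto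
    then have nN: "n (Suc i) \<le> N" using L by (simp add: n_def)
    have ns: "n (Suc i) = Suc (n i) + (p + q)" by (simp add: n_def)
    \<comment> \<open>The next coarse scale is at least as fine as the present fine scale, so no
      gain is lost between comparisons.\<close>
    have "e (Suc (n i)) + (p + q) \<le> e (n (Suc i))"
      unfolding ns using nN ns by (intro grow) auto
    then have "V (e (Suc (n i)) + p) \<le> V (e (n (Suc i)) - q)"
      by (intro V_mono) auto
    moreover have "V (e (n i) - q) + \<kappa> \<le> V (e (Suc (n i)) + p)"
      using nN ns p by (intro gain) (auto simp: n_def)
    ultimately show ?case using Suc by (simp add: algebra_simps)
  qed
  from this[of L] have "real L * \<kappa> \<le> V (e (n L) - q)" by simp
  also have "\<dots> \<le> 2 * D + 2 * D"
    unfolding V_def using lipf lipg by (intro add_mono dyadic_variation_lipschitz)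
  finally show ?thesis by (simp add: \<kappa>_def)
qed

section \<open>Transversality of the two directions\<close>

text \<open>Three vectors in the plane are linearly dependent, so the Gram determinant of
  \<open>v\<close>, \<open>w\<close>, \<open>w'\<close> vanishes; this is its expansion for unit
  \<open>w\<close>, \<open>w'\<close>.\<close>

lemma gram_identity_2:
  fixes v w w' :: "real^2"
  assumes "norm w = 1" "norm w' = 1"
  shows "(norm v)\<^sup>2 * (1 - (w \<bullet> w')\<^sup>2)
    = (v \<bullet> w)\<^sup>2 + (v \<bullet> w')\<^sup>2 - 2 * (w \<bullet> w') * (v \<bullet> w) * (v \<bullet> w')"
proof -
  have 1: "w$1 * w$1 + w$2 * w$2 = 1" "w'$1 * w'$1 + w'$2 * w'$2 = 1"
    using assms by (simp_all add: norm_eq_1 inner_vec_def sum_2)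
  show ?thesis
    unfolding power2_norm_eq_inner using 1
    by (simp add: inner_vec_def sum_2) algebra
qed

text \<open>Bounding \<open>w \<bullet> w'\<close> by 1 in the cross term of the Gram identity
  completes the square. For \<open>t = cos d\<close> with \<open>d\<close> in [0, pi] the constant
  is \<open>sin d\<close>.\<close>

lemma transversal_inner_bound:
  fixes v w w' :: "real^2"
  assumes w: "norm w = 1" "norm w' = 1" and t: "\<bar>w \<bullet> w'\<bar> \<le> t" "t \<le> 1"
  shows "sqrt (1 - t\<^sup>2) * norm v \<le> \<bar>v \<bullet> w\<bar> + \<bar>v \<bullet> w'\<bar>"
proof -
  have t2: "(w \<bullet> w')\<^sup>2 \<le> t\<^sup>2" "t\<^sup>2 \<le> 1" using t power_mono[of "\<bar>w \<bullet> w'\<bar>" t 2] by (auto simp: power_le_one)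
  have "(sqrt (1 - t\<^sup>2) * norm v)\<^sup>2 = (norm v)\<^sup>2 * (1 - t\<^sup>2)"
    using t2 by (simp add: power_mult_distrib)
  also have "\<dots> \<le> (norm v)\<^sup>2 * (1 - (w \<bullet> w')\<^sup>2)"
    using t2 by (intro mult_left_mono) auto
  also have "\<dots> = (v \<bullet> w)\<^sup>2 + (v \<bullet> w')\<^sup>2 - 2 * (w \<bullet> w') * (v \<bullet> w) * (v \<bullet> w')"
    by (rule gram_identity_2[OF w])
  also have "\<dots> \<le> (v \<bullet> w)\<^sup>2 + (v \<bullet> w')\<^sup>2 + 2 * \<bar>v \<bullet> w\<bar> * \<bar>v \<bullet> w'\<bar>"
  proof -
    have "- ((w \<bullet> w') * ((v \<bullet> w) * (v \<bullet> w'))) \<le> \<bar>w \<bullet> w'\<bar> * \<bar>(v \<bullet> w) * (v \<bullet> w')\<bar>"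
      by (metis abs_ge_minus_self abs_mult)
    also have "\<dots> \<le> 1 * \<bar>(v \<bullet> w) * (v \<bullet> w')\<bar>"
      using t by (intro mult_right_mono) auto
    finally show ?thesis by (simp add: abs_mult mult_ac)
  qed
  also have "\<dots> = (\<bar>v \<bullet> w\<bar> + \<bar>v \<bullet> w'\<bar>)\<^sup>2"
    by (simp add: power2_sum)
  finally show ?thesis by (rule power2_le_imp_le) simp
qed

lemma inner_le_cos_of_uangle:
  assumes "norm w = 1" "norm w' = 1" "0 \<le> d" "d \<le> uangle w w'"
  shows "w \<bullet> w' \<le> cos d"
proof -
  have "\<bar>w \<bullet> w'\<bar> \<le> 1" using Cauchy_Schwarz_ineq2[of w w'] assms by simp
  then have "-1 \<le> w \<bullet> w'" "w \<bullet> w' \<le> 1" by auto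
  then have "cos (arccos (w \<bullet> w')) = w \<bullet> w'" "arccos (w \<bullet> w') \<le> pi"
    by (auto intro: arccos_ubound)
  moreover from this have "cos (arccos (w \<bullet> w')) \<le> cos d"
    using assms by (intro cos_monotone_0_pi_le) (auto simp: uangle_def)
  ultimately show ?thesis by simp
qed

section \<open>The hit set of a Lipschitz graph\<close>

text \<open>The parameter is the \<open>w1\<close>-coordinate of a point of the unit ball. Hence the
  grid on [-1,1] suffices for every \<open>J\<close>.\<close>

lemma graph_hit_subset_unit_interval:
  assumes "E \<subseteq> ball 0 1" "norm w1 = 1" "w1 \<bullet> w2 = 0"
  shows "graph_hit E w1 w2 F \<epsilon> J \<subseteq> {-1..<1}"
proof
  fix x assume "x \<in> graph_hit E w1 w2 F \<epsilon> J"
  then obtain y where "x *\<^sub>R w1 + (F x + y) *\<^sub>R w2 \<in> E" (is "?P \<in> E")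
    by (auto simp: graph_hit_def)
  then have "norm ?P < 1" using assms(1) by auto
  moreover have "?P \<bullet> w1 = x"
    using assms(2,3) by (simp add: inner_add_left inner_commute[of w2 w1] norm_eq_1)
  moreover have "\<bar>?P \<bullet> w1\<bar> \<le> norm ?P"
    using Cauchy_Schwarz_ineq2[of ?P w1] assms(2) by simp
  ultimately show "x \<in> {-1..<1}" by auto
qed

text \<open>The scale count for \<open>q = nat \<lceil>x\<rceil>\<close>, \<open>p = q + 3\<close>
  and \<open>L = nat \<lceil>x\<^sup>2\<rceil>\<close>. It is at most 19 times the cube of
  \<open>x\<close>; that cube is at most \<open>sqrt N\<close>, and 19 is at most
  \<open>sqrt N\<close> because 361 is the square of 19.\<close>

lemma enough_scales:
  fixes N :: nat and x :: real
  defines "x \<equiv> real N powr (1/100)"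
  assumes N: "361 \<le> N"
  shows "nat \<lceil>x\<rceil> + 1 + nat \<lceil>x\<^sup>2\<rceil> * (nat \<lceil>x\<rceil> + 3 + nat \<lceil>x\<rceil> + 1) \<le> N"
proof -
  have x1: "1 \<le> x" unfolding x_def using N by (intro ge_one_powr_ge_zero) auto
  then have x2: "1 \<le> x\<^sup>2" "x \<le> x ^ 3" "1 \<le> x ^ 3"
    by (auto simp: one_le_power intro: self_le_power)
  have q: "real (nat \<lceil>x\<rceil>) \<le> 2 * x" using x1 by linarith
  have L: "real (nat \<lceil>x\<^sup>2\<rceil>) \<le> 2 * x\<^sup>2" using x2 by linarith
  have "real (nat \<lceil>x\<^sup>2\<rceil>) * (2 * real (nat \<lceil>x\<rceil>) + 4) \<le> (2 * x\<^sup>2) * (8 * x)"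
    using q L x1 by (intro mult_mono) auto
  also have "\<dots> = 16 * x ^ 3" by (simp add: power2_eq_square power3_eq_cube)
  finally have "real (nat \<lceil>x\<rceil>) + 1 + real (nat \<lceil>x\<^sup>2\<rceil>) * (2 * real (nat \<lceil>x\<rceil>) + 4) \<le> 19 * x ^ 3"
    using q x2 by linarith
  also have "x ^ 3 = real N powr (3/100)"
    using powr_realpow[of x 3] x1 N by (simp add: x_def powr_powr)
  also have "19 * real N powr (3/100) \<le> sqrt N * sqrt N"
  proof (intro mult_mono)
    show "19 \<le> sqrt (real N)" using N by (intro real_le_rsqrt) simp
    show "real N powr (3/100) \<le> sqrt N"
      using N by (simp add: powr_half_sqrt[symmetric] powr_mono)
  qed auto
  also have "\<dots> = real N" by simp
  finally have "real (nat \<lceil>x\<rceil> + 1 + nat \<lceil>x\<^sup>2\<rceil> * (nat \<lceil>x\<rceil> + 3 + nat \<lceil>x\<rceil> + 1)) \<le> real N"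
    by (simp add: algebra_simps)
  then show ?thesis by (simp only: of_nat_le_iff)
qed

lemma graph_hit_measure_bound:
  fixes E :: "(real^2) set" and w w' w1 w2 :: "real^2" and N :: nat and r :: "nat \<Rightarrow> real"
  assumes E: "bounded E" "E \<subseteq> ball 0 1" and w: "norm w = 1" "norm w' = 1"
    and c: "0 < c" "c \<le> 1" and trans: "\<And>v. c * norm v \<le> \<bar>v \<bullet> w\<bar> + \<bar>v \<bullet> w'\<bar>"
    and N: "1 \<le> N"
    and dec: "\<And>n. \<lbrakk>1 \<le> n; n < N\<rbrakk> \<Longrightarrow> r (n + 1) < r n"
    and dyadic: "\<And>n. \<lbrakk>1 \<le> n; n \<le> N\<rbrakk> \<Longrightarrow> \<exists>k::nat. r n = 1 / 2 ^ k"
    and small: "\<And>n. \<lbrakk>1 \<le> n; n < N\<rbrakk> \<Longrightarrow> measure lebesgue (nbhd (r (n + 1)) (proj E w)) \<le> r n"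
    and small': "\<And>n. \<lbrakk>1 \<le> n; n < N\<rbrakk> \<Longrightarrow> measure lebesgue (nbhd (r (n + 1)) (proj E w')) \<le> r n"
    and on: "norm w1 = 1" "norm w2 = 1" "w1 \<bullet> w2 = 0"
    and F: "(real N powr (1/100))-lipschitz_on UNIV F"
  shows "measure lebesgue (graph_hit E w1 w2 F (r N) J) \<le> 16 / c * real N powr (- (1/100))"
proof (rule ccontr)
  define x where "x = real N powr (1/100)"
  define G where "G = graph_hit E w1 w2 F (r N) J"
  have x1: "1 \<le> x" unfolding x_def using N by (intro ge_one_powr_ge_zero) auto
  have G: "G \<subseteq> {-1..<1}"
    unfolding G_def by (rule graph_hit_subset_unit_interval[OF E(2) on(1,3)])
  assume "\<not> ?thesis"
  then have big: "16 / (c * x) < measure lebesgue G"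
    by (simp add: G_def x_def powr_minus field_simps)
  have G2: "measure lebesgue G \<le> 2"
  proof (cases "G \<in> sets lebesgue")
    case True
    then have "measure lebesgue G \<le> measure lebesgue {-1..1::real}"
      using G by (intro measure_mono_fmeasurable) auto
    then show ?thesis by simp
  qed (simp add: measure_notin_sets)
  \<comment> \<open>For smaller \<open>N\<close> the claim is trivial: \<open>x \<le> 2\<close> and
    \<open>c \<le> 1\<close> make the bound at least 8, while \<open>G\<close> has measure at most
    2.\<close>
  have "361 \<le> N"
  proof (rule ccontr)
    assume "\<not> 361 \<le> N"
    then have "x \<le> (2 ^ 100) powr (1/100)"
      unfolding x_def by (intro powr_mono2) auto
    also have "(2::real) ^ 100 = 2 powr 100" using powr_realpow[of 2 100] by simp
    also have "(2 powr 100) powr (1/100) = (2::real)" by (subst powr_powr) simp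
    finally have "c * x \<le> 1 * 2" using c x1 by (intro mult_mono) auto
    moreover have "0 < c * x" using c x1 by simp
    ultimately have "16 / (c * x) \<ge> 16 / 2" by (intro divide_left_mono) auto
    then show False using big G2 by simp
  qed
  obtain e where e: "\<And>n. \<lbrakk>1 \<le> n; n \<le> N\<rbrakk> \<Longrightarrow> r n = 1 / 2 ^ e n"
    using dyadic by metis
  define f where "f t = (t *\<^sub>R w1 + F t *\<^sub>R w2) \<bullet> w" for t
  define g where "g t = (t *\<^sub>R w1 + F t *\<^sub>R w2) \<bullet> w'" for t
  have lipF: "\<bar>F s - F t\<bar> \<le> x * \<bar>s - t\<bar>" for s t
    using lipschitz_onD[OF F, of s t] by (simp add: dist_real_def x_def)
  have diff: "(s *\<^sub>R w1 + F s *\<^sub>R w2) \<bullet> u - (t *\<^sub>R w1 + F t *\<^sub>R w2) \<bullet> u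
      = ((s - t) *\<^sub>R w1 + (F s - F t) *\<^sub>R w2) \<bullet> u" for s t u
    by (simp add: inner_left_distrib inner_diff_left algebra_simps)
  have lip: "\<bar>((s - t) *\<^sub>R w1 + (F s - F t) *\<^sub>R w2) \<bullet> u\<bar> \<le> (1 + x) * \<bar>s - t\<bar>"
    if "norm u = 1" for s t u
  proof -
    have "\<bar>((s - t) *\<^sub>R w1 + (F s - F t) *\<^sub>R w2) \<bullet> u\<bar> \<le> norm ((s - t) *\<^sub>R w1 + (F s - F t) *\<^sub>R w2)"
      using Cauchy_Schwarz_ineq2[of "(s - t) *\<^sub>R w1 + (F s - F t) *\<^sub>R w2" u] that by simp
    also have "\<dots> \<le> \<bar>s - t\<bar> + \<bar>F s - F t\<bar>"
      using on by (intro norm_triangle_le) simp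
    finally show ?thesis using lipF[of s t] by (simp add: algebra_simps)
  qed
  have tr: "c * \<bar>s - t\<bar> \<le> \<bar>f s - f t\<bar> + \<bar>g s - g t\<bar>" for s t
  proof -
    let ?v = "(s - t) *\<^sub>R w1 + (F s - F t) *\<^sub>R w2"
    have "?v \<bullet> w1 = s - t"
      using on by (simp add: inner_add_left inner_commute[of w2 w1] norm_eq_1)
    then have "\<bar>s - t\<bar> \<le> norm ?v"
      using Cauchy_Schwarz_ineq2[of ?v w1] on by simp
    then have "c * \<bar>s - t\<bar> \<le> c * norm ?v" using c by simp
    also note trans[of ?v]
    finally show ?thesis by (simp only: f_def g_def diff)
  qed
  \<comment> \<open>Moving by \<open>y\<close> along the unit vector \<open>w2\<close> from the
    graph to \<open>E\<close> changes the component along \<open>u\<close> by at most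
    \<open>r N\<close>.\<close>
  have near: "\<exists>a\<in>proj E u. \<bar>(t *\<^sub>R w1 + F t *\<^sub>R w2) \<bullet> u - a\<bar> \<le> 1 / 2 ^ e N"
    if "t \<in> G" "norm u = 1" for t u
  proof -
    obtain y where y: "- r N \<le> y" "y \<le> r N" and P: "t *\<^sub>R w1 + (F t + y) *\<^sub>R w2 \<in> E"
      using \<open>t \<in> G\<close> by (auto simp: G_def graph_hit_def)
    have "(t *\<^sub>R w1 + F t *\<^sub>R w2) \<bullet> u - (t *\<^sub>R w1 + (F t + y) *\<^sub>R w2) \<bullet> u = - (y * (w2 \<bullet> u))"
      by (simp add: inner_left_distrib algebra_simps)
    moreover have "\<bar>y * (w2 \<bullet> u)\<bar> \<le> r N * 1"
      unfolding abs_mult using y Cauchy_Schwarz_ineq2[of w2 u] on that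
      by (intro mult_mono) auto
    ultimately show ?thesis
      using P e[of N] N unfolding proj_def by (intro bexI[OF _ imageI[OF P]]) simp
  qed
  have bdd: "bounded (proj E u)" for u
    unfolding proj_def by (intro bounded_linear_image E(1) bounded_linear_inner_left)
  define q where "q = nat \<lceil>x\<rceil>"
  define L where "L = nat \<lceil>x\<^sup>2\<rceil>"
  have "real q < 2 ^ q" by simp
  then have q: "x \<le> 2 ^ q" unfolding q_def using x1 by linarith
  have L: "x\<^sup>2 \<le> real L" unfolding L_def by linarith
  have "real L * (c * measure lebesgue G - 4 / 2 ^ q) \<le> 4 * (1 + x)"
  proof (rule multiscale_variation_bound[where f = f and g = g and N = N and p = "q + 3" and e = e
        and A = "proj E w" and A' = "proj E w'"])
    show "\<bar>f s - f t\<bar> \<le> (1 + x) * \<bar>s - t\<bar>" for s t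
      unfolding f_def diff by (rule lip[OF w(1)])
    show "\<bar>g s - g t\<bar> \<le> (1 + x) * \<bar>s - t\<bar>" for s t
      unfolding g_def diff by (rule lip[OF w(2)])
    show "\<exists>a\<in>proj E w. \<bar>f t - a\<bar> \<le> 1 / 2 ^ e N" if "t \<in> G" for t
      unfolding f_def using near[OF that w(1)] .
    show "\<exists>a\<in>proj E w'. \<bar>g t - a\<bar> \<le> 1 / 2 ^ e N" if "t \<in> G" for t
      unfolding g_def using near[OF that w(2)] .
    show "e n < e (Suc n)" if n: "1 \<le> n" "n < N" for n
    proof -
      have "1 / (2::real) ^ e (Suc n) < 1 / 2 ^ e n"
        using dec[OF n] e[of n] e[of "Suc n"] n by simp
      then have "(2::real) ^ e n < 2 ^ e (Suc n)" by (simp add: field_simps)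
      then show ?thesis by simp
    qed
    show "measure lebesgue (nbhd (1 / 2 ^ e (Suc n)) (proj E w)) \<le> 1 / 2 ^ e n"
      if n: "1 \<le> n" "n < N" for n
      using small[OF n] e[of n] e[of "Suc n"] n by simp
    show "measure lebesgue (nbhd (1 / 2 ^ e (Suc n)) (proj E w')) \<le> 1 / 2 ^ e n"
      if n: "1 \<le> n" "n < N" for n
      using small'[OF n] e[of n] e[of "Suc n"] n by simp
    \<comment> \<open>The 3 in \<open>p = q + 3\<close> supplies a factor 8, and
      \<open>4 * (1 + x) \<le> 8 * x\<close> as \<open>x\<close> is at least 1.\<close>
    show "4 * (1 + x) \<le> 2 ^ (q + 3)"
      using q x1 by (simp add: power_add)
    show "q + 1 + L * (q + 3 + q + 1) \<le> N"
      using enough_scales[OF \<open>361 \<le> N\<close>] unfolding q_def L_def x_def .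
  qed (use x1 c G tr bdd in auto)
  \<comment> \<open>The assumed \<open>16 / x\<close> minus the error \<open>4 / x\<close> leaves
    more than \<open>12 / x\<close> per comparison. At least \<open>x\<^sup>2\<close> comparisons
    give \<open>12 * x\<close>, exceeding the a priori bound \<open>4 * (1 + x)\<close>.\<close>
  moreover have "8 * x < real L * (c * measure lebesgue G - 4 / 2 ^ q)"
  proof -
    have "16 / x < c * measure lebesgue G"
      using big c x1 by (simp add: field_simps)
    moreover have "4 / 2 ^ q \<le> 4 / x" using q x1 by (intro divide_left_mono) auto
    moreover have "16 / x = 12 / x + 4 / x" by (simp flip: add_divide_distrib)
    ultimately have d: "12 / x < c * measure lebesgue G - 4 / 2 ^ q" by linarith
    have "12 * x = x\<^sup>2 * (12 / x)" using x1 by (simp add: power2_eq_square)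
    also have "\<dots> \<le> real L * (c * measure lebesgue G - 4 / 2 ^ q)"
      using L d x1 by (intro mult_mono) auto
    finally show ?thesis using x1 by simp
  qed
  ultimately show False using x1 by simp
qed

section \<open>The bound on the rectifiability constant\<close>

theorem theorem1p14:
  fixes c0 :: real
  assumes "c0 > 0"
  shows "\<exists>C>0. \<forall>(E :: (real^2) set) (w :: real^2) (w' :: real^2) (N :: nat) (r :: nat \<Rightarrow> real).
     compact E \<and> E \<subseteq> ball 0 1 \<and> norm w = 1 \<and> norm w' = 1 \<and>
     uangle w w' \<ge> c0 \<and> uangle w (- w') \<ge> c0 \<and>
     N \<ge> 1 \<and> 0 < r N \<and> r 1 \<le> 1 \<and>
     (\<forall>n. 1 \<le> n \<and> n < N \<longrightarrow> r (n + 1) < r n) \<and>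
     (\<forall>n. 1 \<le> n \<and> n \<le> N \<longrightarrow> (\<exists>k::nat. r n = 1 / 2 ^ k)) \<and>
     (\<forall>n. 1 \<le> n \<and> n < N \<longrightarrow>
        measure lebesgue (nbhd (r (n + 1)) (proj E w)) \<le> r n \<and>
        measure lebesgue (nbhd (r (n + 1)) (proj E w')) \<le> r n)
     \<longrightarrow> rect_const E (r N) 1 (real N powr (1/100)) \<le> C * real N powr (- (1/100))"
proof -
  \<comment> \<open>Capping the angle at pi/2 keeps \<open>sin d\<close> positive for every
    \<open>c0\<close> and only weakens the angle conditions.\<close>
  define d where "d = min c0 (pi/2)"
  have d: "0 < d" "d \<le> pi/2" "d \<le> c0" using assms by (auto simp: d_def)
  define c where "c = sqrt (1 - (cos d)\<^sup>2)"
  have "c = sin d"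
    using d unfolding c_def by (simp add: cos_squared_eq sin_ge_zero)
  then have c: "0 < c" "c \<le> 1" using d by (auto intro: sin_gt_zero)
  show ?thesis
  proof (intro exI[of _ "16 / c"] conjI allI impI, goal_cases)
    case 1
    then show ?case using c by simp
  next
    case (2 E w w' N r)
    let ?M = "real N powr (1/100)"
    let ?Q = "\<lambda>w1 w2 F a b. norm w1 = 1 \<and> norm w2 = 1 \<and> w1 \<bullet> w2 = 0
      \<and> ?M-lipschitz_on UNIV F \<and> b - a \<ge> (1::real)"
    have "w \<bullet> w' \<le> cos d"
      using 2 d by (intro inner_le_cos_of_uangle) auto
    \<comment> \<open>The angle with \<open>- w'\<close> bounds the inner product from below,
      excluding nearly opposite directions.\<close>
    moreover have "w \<bullet> (- w') \<le> cos d"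
      using 2 d by (intro inner_le_cos_of_uangle) auto
    ultimately have "\<bar>w \<bullet> w'\<bar> \<le> cos d" by auto
    then have trans: "c * norm v \<le> \<bar>v \<bullet> w\<bar> + \<bar>v \<bullet> w'\<bar>" for v
      unfolding c_def using 2 by (intro transversal_inner_bound) auto
    have le: "measure lebesgue (graph_hit E w1 w2 F (r N) {a..b}) / measure lebesgue {a..b}
        \<le> 16 / c * real N powr (- (1/100))" if "?Q w1 w2 F a b" for w1 w2 F a b
    proof -
      have "measure lebesgue (graph_hit E w1 w2 F (r N) {a..b}) \<le> 16 / c * real N powr (- (1/100))"
        by (rule graph_hit_measure_bound[where w = w and w' = w'])
          (use 2 that c trans in \<open>simp_all add: compact_imp_bounded\<close>)
      \<comment> \<open>The interval has length at least 1, so dividing by its length cannot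
        increase the value.\<close>
      moreover have "measure lebesgue (graph_hit E w1 w2 F (r N) {a..b}) / measure lebesgue {a..b}
          \<le> measure lebesgue (graph_hit E w1 w2 F (r N) {a..b}) / 1"
        using that by (intro divide_left_mono) auto
      ultimately show ?thesis by simp
    qed
    \<comment> \<open>Bounding a real \<open>Sup\<close> by \<open>cSup_least\<close> requires a
      nonempty set; the zero function on [0,1] is a witness.\<close>
    have "?Q (axis 1 1 :: real^2) (axis 2 1) (\<lambda>_. 0) 0 1"
      by (simp add: norm_eq_1 inner_axis_axis lipschitz_on_def)
    then have ne: "{measure lebesgue (graph_hit E w1 w2 F (r N) {a..b}) / measure lebesgue {a..b} | w1 w2 F a b.
        ?Q w1 w2 F a b} \<noteq> {}"
      by blast
    show ?case
      unfolding rect_const_def using le by (intro cSup_least[OF ne]) blast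
  qed
qed

end
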